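(* Let $n\ge 1$ and let $\|\cdot\|$ be a symmetric norm on $\mathbb{R}^n$. For every $f,g\in\mathbb{R}^n$, $$\|fg-\mathbb{E}(fg)\|\le \|g\|_\infty\,\|f-\mathbb{E}f\|+\|f\|_\infty\,\|g-\mathbb{E}g\|.$$
   Context: A norm on $\mathbb{R}^n$ is symmetric if it is invariant under sign changes of the coordinates and under permutations of the coordinates. For $f,g\in\mathbb{R}^n$, $fg$ is the pointwise (coordinatewise) product, $\|f\|_\infty=\max_i|f_i|$, $\mathbf{1}\in\mathbb{R}^n$ is the constant $1$ vector, and $\mathbb{E}f=\left(\frac1n\sum_{i=1}^n f_i\right)\mathbf{1}\in\mathbb{R}^n$. *)

theory Defs
  imports "HOL-Analysis.Analysis"
begin

(* Norms on real^'n are predicates on functions rather than the type-class norm, which is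
   the fixed Euclidean one. *)
definition is_norm :: "(real^'n \<Rightarrow> real) \<Rightarrow> bool" where
  "is_norm N \<longleftrightarrow>
     (\<forall>x. 0 \<le> N x) \<and>
     (\<forall>x. N x = 0 \<longleftrightarrow> x = 0) \<and>
     (\<forall>c x. N (c *\<^sub>R x) = \<bar>c\<bar> * N x) \<and>
     (\<forall>x y. N (x + y) \<le> N x + N y)"

definition symmetric_norm :: "(real^'n \<Rightarrow> real) \<Rightarrow> bool" where
  "symmetric_norm N \<longleftrightarrow>
     is_norm N \<and>
     (\<forall>s x. (\<forall>i. s i = 1 \<or> s i = - 1) \<longrightarrow> N (\<chi> i. s i * x $ i) = N x) \<and>
     (\<forall>p x. bij p \<longrightarrow> N (\<chi> i. x $ p i) = N x)"

(* The mean as a constant vector; 1 :: real^'n is the all-ones vector. *)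
definition mean_vec :: "real^'n \<Rightarrow> real^'n" where
  "mean_vec f = ((1 / real CARD('n)) * (\<Sum>i\<in>UNIV. f $ i)) *\<^sub>R 1"

end

theory Submission
  imports Defs
begin

text \<open>
  Write \<open>E h\<close> for the mean of \<open>h\<close>, \<open>f\<^sub>0 = f - E f\<close> and \<open>g\<^sub>0 = g - E g\<close>, and for vectors
  \<open>f\<close>, \<open>x\<close> put
  \<open>(A f x) i = (1/n) (\<Sum>j. ((f i + f j) x i + (f i - f j) x j) / 2)\<close>.
  A computation shows that \<open>f g - E (f g) = A f g\<^sub>0 + A g f\<^sub>0\<close>: since \<open>g\<^sub>0\<close> has sum zero,
  \<open>A f g\<^sub>0 = (f + E f) g\<^sub>0 / 2 - E (f g\<^sub>0) / 2 = f g / 2 - E (f g) / 2 + (g E f - f E g) / 2\<close>,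
  and the last summand changes sign when \<open>f\<close> and \<open>g\<close> are exchanged. It
  therefore suffices that \<open>A f\<close> has operator norm at most \<open>\<bar>f\<bar>\<^sub>\<infinity>\<close>.
  This is plausible because \<open>\<bar>f i + f j\<bar> + \<bar>f i - f j\<bar> = 2 max \<bar>f i\<bar> \<bar>f j\<bar>\<close> bounds all absolute row
  and column sums of \<open>A f\<close> by \<open>\<bar>f\<bar>\<^sub>\<infinity>\<close>, and matrices bounded in this way are averages of signed
  permutation matrices, up to that factor.

  The special form of \<open>A f\<close> makes such an average explicit. Identify the indices with the
  residues modulo \<open>n\<close>. The reflections \<open>i \<mapsto> c - i\<close> send each \<open>i\<close> to each \<open>j\<close> exactly once, so
  \<open>A f\<close> is the average over \<open>c\<close> of operators \<open>pair_mix\<close> that only mix \<open>x i\<close> with \<open>x (c - i)\<close>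
  (\<open>sum_pair_mix\<close>). Each of them is linear in \<open>f\<close>, so by convexity it is enough to bound it when
  all entries of \<open>f\<close> are \<open>r\<close> or \<open>-r\<close> with \<open>r = \<bar>f\<bar>\<^sub>\<infinity>\<close>, and then it is \<open>r\<close> times a signed
  permutation (\<open>norm_pair_mix_le\<close>).
\<close>

definition pair_mix :: "('n \<Rightarrow> 'n) \<Rightarrow> real^'n \<Rightarrow> real^'n \<Rightarrow> real^'n" where
  "pair_mix \<sigma> f x = (\<chi> i. ((f $ i + f $ \<sigma> i) * x $ i + (f $ i - f $ \<sigma> i) * x $ \<sigma> i) / 2)"

lemma is_norm_scale: "is_norm N \<Longrightarrow> N (c *\<^sub>R x) = \<bar>c\<bar> * N x"
  by (simp add: is_norm_def)

lemma is_norm_triangle: "is_norm N \<Longrightarrow> N (x + y) \<le> N x + N y"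
  by (simp add: is_norm_def)

lemma is_norm_zero: "is_norm N \<Longrightarrow> N 0 = 0"
  by (simp add: is_norm_def)

lemma is_norm_sum:
  assumes "is_norm N"
  shows "N (\<Sum>c\<in>C. h c) \<le> (\<Sum>c\<in>C. N (h c))"
proof (induction C rule: infinite_finite_induct)
  case (insert c C)
  then show ?case
    using is_norm_triangle[OF assms, of "h c" "\<Sum>c\<in>C. h c"] by simp
qed (use is_norm_zero[OF assms] in auto)

lemma symmetric_norm_signed_perm:
  assumes "symmetric_norm N" and s: "\<And>i. s i = 1 \<or> s i = -1" and p: "bij p"
  shows "N (\<chi> i. s i * x $ p i) = N x"
proof -
  have "N (\<chi> i. s i * (\<chi> i. x $ p i) $ i) = N (\<chi> i. x $ p i)"
    using assms(1) s unfolding symmetric_norm_def by blast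
  also have "\<dots> = N x"
    using assms(1) p unfolding symmetric_norm_def by blast
  finally show ?thesis by simp
qed

text \<open>
  For a sign vector \<open>f\<close>, the coordinates \<open>i\<close> and \<open>\<sigma> i\<close> are left in place if \<open>f\<close> agrees on
  them and are exchanged otherwise, in both cases with a sign. As \<open>\<sigma>\<close> is an involution,
  this is a permutation.
\<close>

lemma norm_pair_mix_signs:
  assumes N: "symmetric_norm N" and inv: "\<And>i. \<sigma> (\<sigma> i) = i"
    and f: "\<And>i. f $ i = 1 \<or> f $ i = -1"
  shows "N (pair_mix \<sigma> f x) = N x"
proof -
  define p where "p i = (if f $ \<sigma> i = f $ i then i else \<sigma> i)" for i
  have "p (p i) = i" for i
    using inv by (auto simp: p_def)
  then have "bij p"
    by (metis involuntory_imp_bij)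
  moreover have "pair_mix \<sigma> f x = (\<chi> i. f $ i * x $ p i)"
    unfolding pair_mix_def vec_eq_iff
  proof
    fix i
    show "(\<chi> i. ((f $ i + f $ \<sigma> i) * x $ i + (f $ i - f $ \<sigma> i) * x $ \<sigma> i) / 2) $ i
            = (\<chi> i. f $ i * x $ p i) $ i"
      using f[of i] f[of "\<sigma> i"] by (auto simp: p_def)
  qed
  ultimately show ?thesis
    using symmetric_norm_signed_perm[OF N f] by simp
qed

text \<open>
  The norm of \<open>pair_mix \<sigma> f x\<close> is a convex function of \<open>f\<close>, so on the cube of radius \<open>c\<close> it is
  at most its maximum over the vertices. The cube is parametrised by the unit cube because
  that one is known to be the convex hull of its vertices.
\<close>

lemma norm_pair_mix_le:
  fixes N :: "real^'n \<Rightarrow> real"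
  assumes N: "symmetric_norm N" and inv: "\<And>i. \<sigma> (\<sigma> i) = i"
    and f: "\<And>i. \<bar>f $ i\<bar> \<le> c"
  shows "N (pair_mix \<sigma> f x) \<le> c * N x"
proof (cases "c = 0")
  case True
  then have "f = 0"
    using f by (simp add: vec_eq_iff)
  then have "pair_mix \<sigma> f x = 0"
    by (simp add: pair_mix_def vec_eq_iff)
  then show ?thesis
    using True N by (simp add: symmetric_norm_def is_norm_zero)
next
  case False
  have norm: "is_norm N"
    using N by (simp add: symmetric_norm_def)
  have c: "c > 0"
    using False f[of undefined] by linarith
  define \<Phi> where "\<Phi> h = N (pair_mix \<sigma> (2 *\<^sub>R h - 1) x)" for h :: "real^'n"
  define V :: "(real^'n) set" where "V = {h. \<forall>b\<in>Basis. h \<bullet> b = 0 \<or> h \<bullet> b = 1}"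
  have cube: "cbox 0 One = convex hull V"
    unfolding V_def by (rule unit_interval_convex_hull)
  have "convex_on UNIV \<Phi>"
  proof (rule convex_onI)
    fix t :: real and h k :: "real^'n"
    assume t: "0 < t" "t < 1"
    have "pair_mix \<sigma> (2 *\<^sub>R ((1 - t) *\<^sub>R h + t *\<^sub>R k) - 1) x
        = (1 - t) *\<^sub>R pair_mix \<sigma> (2 *\<^sub>R h - 1) x + t *\<^sub>R pair_mix \<sigma> (2 *\<^sub>R k - 1) x"
      by (simp add: pair_mix_def vec_eq_iff field_simps)
    then show "\<Phi> ((1 - t) *\<^sub>R h + t *\<^sub>R k) \<le> (1 - t) * \<Phi> h + t * \<Phi> k"
      using is_norm_triangle[OF norm, of "(1 - t) *\<^sub>R pair_mix \<sigma> (2 *\<^sub>R h - 1) x"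
          "t *\<^sub>R pair_mix \<sigma> (2 *\<^sub>R k - 1) x"] t
      by (simp add: \<Phi>_def is_norm_scale[OF norm])
  qed simp
  then have "convex_on (convex hull V) \<Phi>"
    by (rule convex_on_subset) simp_all
  moreover have "\<Phi> h \<le> N x" if "h \<in> V" for h
  proof -
    have *: "h $ i = 0 \<or> h $ i = 1" for i
      using that by (auto simp: V_def Basis_vec_def inner_axis)
    have "(2 *\<^sub>R h - 1) $ i = 1 \<or> (2 *\<^sub>R h - 1) $ i = -1" for i
      using *[of i] by (auto simp: algebra_simps)
    then show ?thesis
      unfolding \<Phi>_def using norm_pair_mix_signs[OF N inv] by simp
  qed
  ultimately have bound: "\<Phi> h \<le> N x" if "h \<in> cbox 0 One" for h
    using convex_on_convex_hull_bound[of V \<Phi> "N x"] that cube by blast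
  define h :: "real^'n" where "h = (\<chi> i. (f $ i / c + 1) / 2)"
  have "0 \<le> h $ i \<and> h $ i \<le> 1" for i
    using f[of i] c by (simp add: h_def field_simps abs_le_iff)
  then have "\<forall>b\<in>Basis. 0 \<le> h \<bullet> b \<and> h \<bullet> b \<le> 1"
    by (auto simp: Basis_vec_def inner_axis)
  then have "h \<in> cbox 0 One"
    by (simp add: mem_box)
  then have "\<Phi> h \<le> N x"
    by (rule bound)
  moreover have "pair_mix \<sigma> f x = c *\<^sub>R pair_mix \<sigma> (2 *\<^sub>R h - 1) x"
    using c by (simp add: pair_mix_def h_def vec_eq_iff field_simps)
  ultimately show ?thesis
    using c by (simp add: \<Phi>_def is_norm_scale[OF norm])
qed

text \<open>
  The reflections \<open>i \<mapsto> c - i\<close> of the cyclic group decompose all pairs of indices into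
  involutions: they form a round-robin schedule.
\<close>

lemma round_robin_involutions:
  obtains \<sigma> :: "int \<Rightarrow> 'n::finite \<Rightarrow> 'n" where
    "\<And>c i. \<sigma> c (\<sigma> c i) = i"
    "\<And>i. bij_betw (\<lambda>c. \<sigma> c i) {0..<int CARD('n)} UNIV"
proof -
  let ?n = "int CARD('n)"
  obtain e :: "'n \<Rightarrow> int" where e: "bij_betw e UNIV {0..<?n}"
    using finite_same_card_bij[of "UNIV :: 'n set" "{0..<?n}"] by auto
  define d where "d = inv_into UNIV e"
  have ed: "e (d k) = k" if "k \<in> {0..<?n}" for k
    using e that by (simp add: d_def bij_betw_inv_into_right)
  have de: "d (e i) = i" for i
    using e by (simp add: d_def bij_betw_inv_into_left)
  have range: "e i \<in> {0..<?n}" for i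
    using e by (auto simp: bij_betw_def)
  define \<sigma> where "\<sigma> c i = d ((c - e i) mod ?n)" for c i
  have e\<sigma>: "e (\<sigma> c i) = (c - e i) mod ?n" for c i
    by (simp add: \<sigma>_def ed)
  show thesis
  proof (rule that)
    fix c i
    have "(c - (c - e i) mod ?n) mod ?n = e i"
      using range[of i] by (simp add: mod_diff_right_eq)
    then show "\<sigma> c (\<sigma> c i) = i"
      by (metis \<sigma>_def e\<sigma> de)
  next
    fix i
    show "bij_betw (\<lambda>c. \<sigma> c i) {0..<?n} UNIV"
    proof (rule bij_betw_byWitness[where f' = "\<lambda>j. (e i + e j) mod ?n"])
      show "\<forall>c\<in>{0..<?n}. (e i + e (\<sigma> c i)) mod ?n = c"
        by (simp add: e\<sigma> mod_add_right_eq)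
      show "\<forall>j\<in>UNIV. \<sigma> ((e i + e j) mod ?n) i = j"
        using range by (simp add: \<sigma>_def mod_diff_left_eq de)
    qed auto
  qed
qed

lemma sum_pair_mix:
  fixes f x :: "real^'n"
  assumes bij: "\<And>i. bij_betw (\<lambda>c. \<sigma> c i) C UNIV"
  shows "(\<Sum>c\<in>C. pair_mix (\<sigma> c) f x) $ i
    = ((real CARD('n) * f $ i + (\<Sum>j\<in>UNIV. f $ j)) * x $ i
        + f $ i * (\<Sum>j\<in>UNIV. x $ j) - (\<Sum>j\<in>UNIV. f $ j * x $ j)) / 2"
proof -
  have "(\<Sum>c\<in>C. pair_mix (\<sigma> c) f x) $ i
      = (\<Sum>c\<in>C. ((f $ i + f $ \<sigma> c i) * x $ i + (f $ i - f $ \<sigma> c i) * x $ \<sigma> c i) / 2)"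
    by (simp add: pair_mix_def)
  also have "\<dots> = (\<Sum>j\<in>UNIV. ((f $ i + f $ j) * x $ i + (f $ i - f $ j) * x $ j) / 2)"
    using bij by (rule sum.reindex_bij_betw)
  also have "\<dots> = ((real CARD('n) * f $ i + (\<Sum>j\<in>UNIV. f $ j)) * x $ i
        + f $ i * (\<Sum>j\<in>UNIV. x $ j) - (\<Sum>j\<in>UNIV. f $ j * x $ j)) / 2"
    by (simp add: sum_divide_distrib[symmetric] sum.distrib sum_subtractf algebra_simps
        sum_distrib_left sum_distrib_right)
  finally show ?thesis .
qed

theorem theorem2p6:
  fixes N :: "real^'n \<Rightarrow> real" and f g :: "real^'n"
  assumes "symmetric_norm N"
  shows "N (f * g - mean_vec (f * g))
           \<le> infnorm g * N (f - mean_vec f) + infnorm f * N (g - mean_vec g)"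
proof -
  let ?n = "real CARD('n)"
  have norm: "is_norm N"
    using assms by (simp add: symmetric_norm_def)
  obtain \<sigma> :: "int \<Rightarrow> 'n \<Rightarrow> 'n" where inv: "\<And>c i. \<sigma> c (\<sigma> c i) = i"
    and bij: "\<And>i. bij_betw (\<lambda>c. \<sigma> c i) {0..<int CARD('n)} UNIV"
    using round_robin_involutions by blast
  define A where
    "A u x = (1 / ?n) *\<^sub>R (\<Sum>c\<in>{0..<int CARD('n)}. pair_mix (\<sigma> c) u x)" for u x :: "real^'n"
  have bound: "N (A u x) \<le> infnorm u * N x" for u x
  proof -
    have "N (\<Sum>c\<in>{0..<int CARD('n)}. pair_mix (\<sigma> c) u x)
        \<le> (\<Sum>c\<in>{0..<int CARD('n)}. N (pair_mix (\<sigma> c) u x))"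
      by (rule is_norm_sum[OF norm])
    also have "\<dots> \<le> (\<Sum>c\<in>{0..<int CARD('n)}. infnorm u * N x)"
      by (intro sum_mono norm_pair_mix_le assms inv component_le_infnorm_cart)
    also have "\<dots> = ?n * (infnorm u * N x)"
      by simp
    finally show ?thesis
      by (simp add: A_def is_norm_scale[OF norm] field_simps)
  qed
  have A: "A u (x - mean_vec x) $ i
      = (u $ i * x $ i) / 2 + ((\<Sum>j\<in>UNIV. u $ j) / ?n * x $ i - u $ i * ((\<Sum>j\<in>UNIV. x $ j) / ?n)) / 2
        - (\<Sum>j\<in>UNIV. u $ j * x $ j) / ?n / 2" for u x i
  proof -
    have zero: "(\<Sum>j\<in>UNIV. (x - mean_vec x) $ j) = 0"
      by (simp add: mean_vec_def sum_subtractf)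
    have prod: "(\<Sum>j\<in>UNIV. u $ j * (x - mean_vec x) $ j)
        = (\<Sum>j\<in>UNIV. u $ j * x $ j) - (\<Sum>j\<in>UNIV. u $ j) * ((\<Sum>j\<in>UNIV. x $ j) / ?n)"
      by (simp add: mean_vec_def right_diff_distrib sum_subtractf sum_distrib_right sum_divide_distrib)
    have "A u (x - mean_vec x) $ i
        = ((?n * u $ i + (\<Sum>j\<in>UNIV. u $ j)) * (x $ i - (\<Sum>j\<in>UNIV. x $ j) / ?n)
            - ((\<Sum>j\<in>UNIV. u $ j * x $ j) - (\<Sum>j\<in>UNIV. u $ j) * ((\<Sum>j\<in>UNIV. x $ j) / ?n))) / 2 / ?n"
      unfolding A_def vector_scaleR_component sum_pair_mix[OF bij] zero prod
      by (simp add: mean_vec_def)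
    also have "\<dots> = (u $ i * x $ i) / 2
        + ((\<Sum>j\<in>UNIV. u $ j) / ?n * x $ i - u $ i * ((\<Sum>j\<in>UNIV. x $ j) / ?n)) / 2
        - (\<Sum>j\<in>UNIV. u $ j * x $ j) / ?n / 2"
      by (simp add: field_simps)
    finally show ?thesis .
  qed
  \<comment> \<open>The middle terms of the formula for \<open>A\<close> are antisymmetric in the two vectors and cancel.\<close>
  have "f * g - mean_vec (f * g) = A g (f - mean_vec f) + A f (g - mean_vec g)"
  proof (subst vec_eq_iff, rule allI)
    fix i
    have "mean_vec (f * g) $ i = (\<Sum>j\<in>UNIV. f $ j * g $ j) / ?n"
      by (simp add: mean_vec_def)
    moreover have "(\<Sum>j\<in>UNIV. g $ j * f $ j) = (\<Sum>j\<in>UNIV. f $ j * g $ j)"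
      by (simp add: mult.commute)
    ultimately show "(f * g - mean_vec (f * g)) $ i
        = (A g (f - mean_vec f) + A f (g - mean_vec g)) $ i"
      by (simp add: A field_simps)
  qed
  then show ?thesis
    using is_norm_triangle[OF norm, of "A g (f - mean_vec f)" "A f (g - mean_vec g)"]
      bound[of g "f - mean_vec f"] bound[of f "g - mean_vec g"] by simp
qed

end
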